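(* Let $1\le p<+\infty$ and let $\sigma$ be a non-decreasing sigmoidal function satisfying: $\sigma(x)-1/2$ is odd; $\sigma\in C^2(\mathbb{R})$ is concave for $x\ge 0$; and $\sigma(x)=\mathcal{O}(|x|^{-1-\alpha})$ as $x\to-\infty$ for some $\alpha>p$. Then there exists a constant $K_1>0$, independent of $n$ and $f$, such that the following holds. For every $f\in C^1(I)$ for which there exist positive constants $M_f,\beta_f>0$ with $$M_f\ \ge\ \left|\frac{\partial f}{\partial x_i}(\mathtt{x})\right|^p\ \ge\ \beta_f\ >0,\qquad \mathtt{x}\in I,\quad i=1,2,$$ one has $$\|F_n(f,\cdot)-f(\cdot)\|_p\ \le\ \frac{K_1}{n}\left(\frac{M_f}{\beta_f}\right)^{1/p}\|f\|_{1,p},\qquad n\in\mathbb{N}^+ .$$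
   Context: A sigmoidal function is $\sigma:\mathbb{R}\to\mathbb{R}$ with $\lim_{x\to-\infty}\sigma(x)=0$ and $\lim_{x\to+\infty}\sigma(x)=1$. Let $I=[a_1,b_1]\times[a_2,b_2]\subset\mathbb{R}^2$ (dimension $d=2$). Functions $f:I\to\mathbb{R}$ and their partial derivatives are regarded as extended to $\mathbb{R}^2$ by periodicity in each variable. Set $\phi_\sigma(x)=\frac12[\sigma(x+1)-\sigma(x-1)]$ for $x\in\mathbb{R}$, $\Psi_\sigma(\mathtt{x})=\phi_\sigma(x_1)\phi_\sigma(x_2)$ for $\mathtt{x}=(x_1,x_2)\in\mathbb{R}^2$, and $\mathcal{A}_n=\{\mathtt{k}\in\mathbb{Z}^2:\lceil na_i\rceil\le k_i\le\lfloor nb_i\rfloor,\ i=1,2\}$. The neural network operators are $$F_n(f,\mathtt{x})=\frac{\sum_{\mathtt{k}\in\mathcal{A}_n}f(\mathtt{k}/n)\,\Psi_\sigma(n\mathtt{x}-\mathtt{k})}{\sum_{\mathtt{k}\in\mathcal{A}_n}\Psi_\sigma(n\mathtt{x}-\mathtt{k})},\qquad \mathtt{x}\in I,\ \mathtt{k}/n=(k_1/n,k_2/n),$$ considered for those $n\in\mathbb{N}^+$ for which $\mathcal{A}_n\neq\emptyset$. $\|\cdot\|_p$ is the $L^p(I)$-norm with respect to Lebesgue measure, and $\|f\|_{1,p}=\|f\|_p+\sum_{i=1}^2\|\partial f/\partial x_i\|_p$. *)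

theory Defs
  imports "HOL-Analysis.Analysis" "HOL-Library.Landau_Symbols"
begin

definition sigmoidal :: "(real \<Rightarrow> real) \<Rightarrow> bool" where
  "sigmoidal \<sigma> \<longleftrightarrow> (\<sigma> \<longlongrightarrow> 0) at_bot \<and> (\<sigma> \<longlongrightarrow> 1) at_top"

definition C2_real :: "(real \<Rightarrow> real) \<Rightarrow> bool" where
  "C2_real g \<longleftrightarrow>
     (\<forall>x. g differentiable (at x)) \<and>
     (\<forall>x. deriv g differentiable (at x)) \<and>
     continuous_on UNIV (deriv (deriv g))"

definition phi :: "(real \<Rightarrow> real) \<Rightarrow> real \<Rightarrow> real" where
  "phi \<sigma> x = (\<sigma> (x + 1) - \<sigma> (x - 1)) / 2"

definition Psi :: "(real \<Rightarrow> real) \<Rightarrow> real ^ 2 \<Rightarrow> real" where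
  "Psi \<sigma> x = phi \<sigma> (x $ 1) * phi \<sigma> (x $ 2)"

definition grid :: "real ^ 2 \<Rightarrow> real ^ 2 \<Rightarrow> nat \<Rightarrow> (int ^ 2) set" where
  "grid a b n = {k. \<forall>i. \<lceil>real n * a $ i\<rceil> \<le> k $ i \<and> k $ i \<le> \<lfloor>real n * b $ i\<rfloor>}"

definition vec_of_int :: "int ^ 2 \<Rightarrow> real ^ 2" where
  "vec_of_int k = (\<chi> i. real_of_int (k $ i))"

text \<open>
  The operator evaluates \<open>f\<close> only at points \<open>k/n\<close> of the rectangle \<open>cbox a b\<close>,
  so no extension of \<open>f\<close> outside the rectangle enters its value there.
\<close>

definition nn_op ::
  "(real \<Rightarrow> real) \<Rightarrow> real ^ 2 \<Rightarrow> real ^ 2 \<Rightarrow> nat \<Rightarrow> (real ^ 2 \<Rightarrow> real) \<Rightarrow> real ^ 2 \<Rightarrow> real" where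
  "nn_op \<sigma> a b n f x =
     (\<Sum>k\<in>grid a b n. f (vec_of_int k /\<^sub>R real n) * Psi \<sigma> (real n *\<^sub>R x - vec_of_int k)) /
     (\<Sum>k\<in>grid a b n. Psi \<sigma> (real n *\<^sub>R x - vec_of_int k))"

text \<open>
  The partial derivative is taken along the part of the coordinate line that stays in \<open>S\<close>:
  for a rectangle \<open>cbox a b\<close> with \<open>a $ i < b $ i\<close> for all \<open>i\<close>, it is the usual two-sided
  derivative away from the faces orthogonal to the line and the one-sided derivative on them,
  and it never depends on the values of \<open>f\<close> outside the rectangle.
\<close>

definition axis_slice :: "(real ^ 2) set \<Rightarrow> 2 \<Rightarrow> real ^ 2 \<Rightarrow> real set" where
  "axis_slice S i x = {t. x + t *\<^sub>R axis i 1 \<in> S}"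

definition partial :: "(real ^ 2) set \<Rightarrow> 2 \<Rightarrow> (real ^ 2 \<Rightarrow> real) \<Rightarrow> real ^ 2 \<Rightarrow> real" where
  "partial S i f x =
     vector_derivative (\<lambda>t. f (x + t *\<^sub>R axis i 1)) (at 0 within axis_slice S i x)"

definition C1_on :: "(real ^ 2) set \<Rightarrow> (real ^ 2 \<Rightarrow> real) \<Rightarrow> bool" where
  "C1_on S f \<longleftrightarrow>
     continuous_on S f \<and>
     (\<forall>i. \<forall>x\<in>S. (\<lambda>t. f (x + t *\<^sub>R axis i 1)) differentiable (at 0 within axis_slice S i x)) \<and>
     (\<forall>i. continuous_on S (partial S i f))"

text \<open>
  The Bochner integral is \<open>0\<close> for non-integrable functions, so \<open>Lp_norm\<close> is the \<open>L\<^sup>p\<close> norm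
  only for functions with an integrable \<open>p\<close>-th power, in particular for functions
  continuous on a compact \<open>S\<close>.
\<close>

definition Lp_norm :: "real \<Rightarrow> (real ^ 2) set \<Rightarrow> (real ^ 2 \<Rightarrow> real) \<Rightarrow> real" where
  "Lp_norm p S g = (LINT x:S|lebesgue. \<bar>g x\<bar> powr p) powr (1 / p)"

definition Sobolev_norm :: "real \<Rightarrow> (real ^ 2) set \<Rightarrow> (real ^ 2 \<Rightarrow> real) \<Rightarrow> real" where
  "Sobolev_norm p S f = Lp_norm p S f + (\<Sum>i\<in>UNIV. Lp_norm p S (partial S i f))"

end

theory Submission
  imports Defs
begin

text \<open>
  The two-sided bound on the partial derivatives reduces the \<open>L\<^sup>p\<close> estimate to a uniform one.
  The upper bound \<open>M\<close> makes \<open>f\<close> Lipschitz on the rectangle \<open>I\<close> with constant \<open>M\<^sup>1\<^sup>/\<^sup>p\<close> for the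
  \<open>\<ell>\<^sup>1\<close> distance (\<open>box_lipschitz\<close>). Since \<open>F\<^sub>n f x\<close> is an average of the values \<open>f (k/n)\<close> with
  weights \<open>\<Psi> (n x - k)\<close>, the error \<open>F\<^sub>n f x - f x\<close> is at most \<open>M\<^sup>1\<^sup>/\<^sup>p / n\<close> times the weighted mean
  of \<open>\<bar>n x\<^sub>1 - k\<^sub>1\<bar> + \<bar>n x\<^sub>2 - k\<^sub>2\<bar>\<close>.

  This mean is bounded independently of \<open>n\<close> and \<open>x\<close>. The weights factor over the two coordinates,
  so it is a sum of two one-dimensional means (\<open>phi_moment_ratio_bounded\<close>). In one dimension the
  first absolute moment \<open>\<Sum>\<^sub>k \<bar>t - k\<bar> \<phi> (t - k)\<close> is bounded uniformly in \<open>t\<close>, because the decay of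
  \<open>\<sigma>\<close> gives \<open>\<bar>x\<bar> \<phi> x = O(\<bar>x\<bar>\<^sup>-\<^sup>\<alpha>)\<close> with \<open>\<alpha> > 1\<close>. The normalising sum is bounded away from \<open>0\<close>:
  some admissible integer lies within distance \<open>1\<close> of \<open>t\<close>, and \<open>\<phi>\<close> is bounded below by a
  positive constant on \<open>[-1, 1]\<close>.

  Taking \<open>L\<^sup>p\<close> norms costs a factor \<open>\<bar>I\<bar>\<^sup>1\<^sup>/\<^sup>p\<close>, and
  \<open>M\<^sup>1\<^sup>/\<^sup>p \<bar>I\<bar>\<^sup>1\<^sup>/\<^sup>p = (M/\<beta>)\<^sup>1\<^sup>/\<^sup>p (\<beta> \<bar>I\<bar>)\<^sup>1\<^sup>/\<^sup>p\<close>. By the lower bound \<open>\<beta>\<close>, the last factor is at most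
  the \<open>L\<^sup>p\<close> norm of \<open>\<partial>f/\<partial>x\<^sub>1\<close>, hence at most the Sobolev norm of \<open>f\<close>. The volume of \<open>I\<close> cancels,
  so the constant depends on \<open>\<sigma>\<close> alone.
\<close>

section \<open>Sums over translated integers\<close>

text \<open>
  The absolute value takes each natural number at most twice on the integers, once on either side
  of zero.
\<close>

lemma sum_nat_abs_le_suminf:
  fixes w :: "nat \<Rightarrow> real" and S :: "int set"
  assumes "summable w" "\<And>i. 0 \<le> w i" "finite S"
  shows "(\<Sum>j\<in>S. w (nat \<bar>j\<bar>)) \<le> 2 * suminf w"
proof -
  have half: "(\<Sum>j\<in>T. w (nat \<bar>j\<bar>)) \<le> suminf w" if "T \<subseteq> S" "inj_on (\<lambda>j. nat \<bar>j\<bar>) T" for T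
  proof -
    have "(\<Sum>j\<in>T. w (nat \<bar>j\<bar>)) = sum w ((\<lambda>j. nat \<bar>j\<bar>) ` T)"
      using that by (simp add: sum.reindex)
    also have "\<dots> \<le> suminf w"
      using assms that by (intro sum_le_suminf) (auto intro: finite_subset)
    finally show ?thesis .
  qed
  have "(\<Sum>j\<in>S. w (nat \<bar>j\<bar>)) = (\<Sum>j\<in>S \<inter> {0..}. w (nat \<bar>j\<bar>)) + (\<Sum>j\<in>S - {0..}. w (nat \<bar>j\<bar>))"
    using assms(3) by (rule sum.Int_Diff)
  also have "\<dots> \<le> suminf w + suminf w"
    by (intro add_mono half) (auto simp: inj_on_def)
  finally show ?thesis by simp
qed

text \<open>
  The bound is uniform in \<open>t\<close> because shifting the summation index by \<open>\<lfloor>t\<rfloor>\<close> leaves only the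
  fractional part of \<open>t\<close>: with \<open>j = k - \<lfloor>t\<rfloor>\<close> one has \<open>1 + \<bar>t - k\<bar> \<ge> \<bar>j\<bar>\<close>, so a summable sequence
  in \<open>\<bar>j\<bar>\<close> that does not depend on \<open>t\<close> dominates the terms.
\<close>

lemma sum_translates_bounded:
  fixes g :: "real \<Rightarrow> real"
  assumes "1 < \<alpha>" "0 \<le> B" and g: "\<And>x. g x \<le> B * (1 + \<bar>x\<bar>) powr (- \<alpha>)"
  shows "\<exists>C\<ge>0. \<forall>t A. finite A \<longrightarrow> (\<Sum>k\<in>A. g (t - real_of_int k)) \<le> C"
proof -
  \<comment> \<open>As \<open>0 powr (- \<alpha>) = 0\<close> by convention, the term at zero, where the bound is \<open>B\<close>, is set apart.\<close>
  define w :: "nat \<Rightarrow> real" where "w i = B * (if i = 0 then 1 else real i powr (- \<alpha>))" for i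
  have "summable (\<lambda>i. real i powr (- \<alpha>))"
    using assms(1) by (simp add: summable_real_powr_iff)
  then have "summable (\<lambda>i. real (Suc i) powr (- \<alpha>))"
    by (subst summable_Suc_iff)
  then have "summable (\<lambda>i. w (Suc i))"
    unfolding w_def by (auto intro: summable_mult)
  then have w: "summable w"
    by (simp only: summable_Suc_iff)
  have w0: "0 \<le> w i" for i
    using assms(2) by (simp add: w_def)
  have "(\<Sum>k\<in>A. g (t - real_of_int k)) \<le> 2 * suminf w" if "finite A" for t and A :: "int set"
  proof -
    have "g (t - real_of_int k) \<le> w (nat \<bar>k - \<lfloor>t\<rfloor>\<bar>)" for k
    proof -
      have *: "real (nat \<bar>k - \<lfloor>t\<rfloor>\<bar>) \<le> 1 + \<bar>t - real_of_int k\<bar>"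
        by linarith
      have "(1 + \<bar>t - real_of_int k\<bar>) powr (- \<alpha>) \<le> (if nat \<bar>k - \<lfloor>t\<rfloor>\<bar> = 0 then 1 else real (nat \<bar>k - \<lfloor>t\<rfloor>\<bar>) powr (- \<alpha>))"
      proof (cases "nat \<bar>k - \<lfloor>t\<rfloor>\<bar> = 0")
        case True
        have "(1 + \<bar>t - real_of_int k\<bar>) powr (- \<alpha>) \<le> 1 powr (- \<alpha>)"
          using assms(1) by (intro powr_mono2') auto
        then show ?thesis using True by simp
      next
        case False
        have "(1 + \<bar>t - real_of_int k\<bar>) powr (- \<alpha>) \<le> real (nat \<bar>k - \<lfloor>t\<rfloor>\<bar>) powr (- \<alpha>)"
          using assms(1) False * by (intro powr_mono2') auto
        then show ?thesis using False by simp
      qed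
      then show ?thesis
        using g[of "t - real_of_int k"] assms(2) unfolding w_def
        by (meson mult_left_mono order_trans)
    qed
    then have "(\<Sum>k\<in>A. g (t - real_of_int k)) \<le> (\<Sum>k\<in>A. w (nat \<bar>k - \<lfloor>t\<rfloor>\<bar>))"
      by (intro sum_mono)
    also have "\<dots> = (\<Sum>j\<in>(\<lambda>k. k - \<lfloor>t\<rfloor>) ` A. w (nat \<bar>j\<bar>))"
      by (simp add: sum.reindex inj_on_def)
    also have "\<dots> \<le> 2 * suminf w"
      using w w0 that by (intro sum_nat_abs_le_suminf) auto
    finally show ?thesis .
  qed
  moreover have "0 \<le> 2 * suminf w"
    using suminf_nonneg[OF w w0] by simp
  ultimately show ?thesis by blast
qed

section \<open>The kernel of a symmetric sigmoidal function\<close>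

lemma sigmoidal_mono_nonneg:
  assumes "sigmoidal \<sigma>" "mono \<sigma>"
  shows "0 \<le> \<sigma> x"
proof (rule tendsto_upperbound)
  show "(\<sigma> \<longlongrightarrow> 0) at_bot" using assms(1) by (simp add: sigmoidal_def)
  show "\<forall>\<^sub>F y in at_bot. \<sigma> y \<le> \<sigma> x"
    using eventually_le_at_bot[of x] by eventually_elim (use assms(2) in \<open>auto dest: monoD\<close>)
qed simp

lemma phi_nonneg: "mono \<sigma> \<Longrightarrow> 0 \<le> phi \<sigma> x"
  by (simp add: phi_def monoD)

lemma phi_minus:
  assumes "\<forall>x. \<sigma> (- x) - 1 / 2 = - (\<sigma> x - 1 / 2)"
  shows "phi \<sigma> (- x) = phi \<sigma> x"
proof -
  have "\<sigma> (- x - 1) = 1 - \<sigma> (x + 1)" "\<sigma> (- x + 1) = 1 - \<sigma> (x - 1)"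
    using assms[rule_format, of "x + 1"] assms[rule_format, of "x - 1"] by simp_all
  then show ?thesis by (simp add: phi_def)
qed

text \<open>
  As \<open>\<phi>\<close> is even, its tails are controlled by the left tail of \<open>\<sigma>\<close>: for large \<open>x > 0\<close> one has
  \<open>\<phi> x = \<phi> (- x) \<le> \<sigma> (1 - x) = O(x\<^sup>-\<^sup>1\<^sup>-\<^sup>\<alpha>)\<close>. The factor \<open>\<bar>x\<bar>\<close> costs one power. On the remaining
  bounded range the left side is bounded and the power on the right is bounded away from \<open>0\<close>.
\<close>

lemma phi_first_moment_decay:
  assumes "sigmoidal \<sigma>" "mono \<sigma>"
    and sym: "\<forall>x. \<sigma> (- x) - 1 / 2 = - (\<sigma> x - 1 / 2)"
    and bigo: "\<sigma> \<in> O[at_bot](\<lambda>x. \<bar>x\<bar> powr (- 1 - \<alpha>))" and "0 \<le> \<alpha>"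
  shows "\<exists>B\<ge>0. \<forall>x. \<bar>x\<bar> * phi \<sigma> x \<le> B * (1 + \<bar>x\<bar>) powr (- \<alpha>)"
proof -
  have nonneg: "0 \<le> \<sigma> x" for x
    using assms(1,2) by (rule sigmoidal_mono_nonneg)
  have le1: "\<sigma> x \<le> 1" for x
    using nonneg[of "- x"] sym[rule_format, of x] by simp
  obtain c where "0 < c" and "\<forall>\<^sub>F x in at_bot. norm (\<sigma> x) \<le> c * norm (\<bar>x\<bar> powr (- 1 - \<alpha>))"
    using bigo by (auto elim: landau_o.bigE)
  then obtain N where N: "\<And>x. x \<le> N \<Longrightarrow> \<sigma> x \<le> c * \<bar>x\<bar> powr (- 1 - \<alpha>)"
    unfolding eventually_at_bot_linorder by (metis abs_le_D1 abs_of_nonneg powr_ge_zero real_norm_def)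
  \<comment> \<open>Beyond \<open>X\<close> the decay of \<open>\<sigma>\<close> applies at \<open>1 - x\<close>, and \<open>x \<ge> 3\<close> ensures \<open>x - 1 \<ge> (1 + x) / 2\<close>.\<close>
  define X where "X = max 3 (1 - N)"
  define B where "B = c * 2 powr (1 + \<alpha>) + X * (1 + X) powr \<alpha>"
  have X: "3 \<le> X" "1 - N \<le> X" by (auto simp: X_def)
  have far: "x * phi \<sigma> x \<le> c * 2 powr (1 + \<alpha>) * (1 + x) powr (- \<alpha>)" if "X \<le> x" for x
  proof -
    have "phi \<sigma> x = phi \<sigma> (- x)" using phi_minus[OF sym] by simp
    also have "\<dots> \<le> \<sigma> (1 - x)"
      using nonneg[of "1 - x"] nonneg[of "- x - 1"] by (simp add: phi_def)
    also have "\<dots> \<le> c * \<bar>1 - x\<bar> powr (- 1 - \<alpha>)"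
      using that X by (intro N) simp
    also have "\<dots> \<le> c * ((1 + x) / 2) powr (- 1 - \<alpha>)"
      using that X \<open>0 < c\<close> \<open>0 \<le> \<alpha>\<close> by (intro mult_left_mono powr_mono2') auto
    also have "((1 + x) / 2) powr (- 1 - \<alpha>) = 2 powr (1 + \<alpha>) * (1 + x) powr (- 1 - \<alpha>)"
    proof -
      have "2 powr (- 1 - \<alpha>) = 1 / (2 powr (1 + \<alpha>) :: real)"
        using powr_minus_divide[of "2::real" "1 + \<alpha>"] by simp
      then show ?thesis
        using that X by (simp add: powr_divide)
    qed
    finally have "x * phi \<sigma> x \<le> (1 + x) * (c * (2 powr (1 + \<alpha>) * (1 + x) powr (- 1 - \<alpha>)))"
      using that X phi_nonneg[OF assms(2), of x] by (intro mult_mono) auto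
    also have "\<dots> = c * 2 powr (1 + \<alpha>) * ((1 + x) powr 1 * (1 + x) powr (- 1 - \<alpha>))"
      using that X by simp
    also have "\<dots> = c * 2 powr (1 + \<alpha>) * (1 + x) powr (- \<alpha>)"
      by (subst powr_add[symmetric]) simp
    finally show ?thesis .
  qed
  have near: "x * phi \<sigma> x \<le> X * (1 + X) powr \<alpha> * (1 + x) powr (- \<alpha>)" if "0 \<le> x" "x \<le> X" for x
  proof -
    have "phi \<sigma> x \<le> 1"
      using le1[of "x + 1"] nonneg[of "x - 1"] by (simp add: phi_def)
    then have "x * phi \<sigma> x \<le> X * 1"
      using that X phi_nonneg[OF assms(2), of x] by (intro mult_mono) auto
    also have "1 = (1 + x) powr \<alpha> * (1 + x) powr (- \<alpha>)"
      using that by (simp flip: powr_add)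
    also have "\<dots> \<le> (1 + X) powr \<alpha> * (1 + x) powr (- \<alpha>)"
      using that \<open>0 \<le> \<alpha>\<close> by (intro mult_right_mono powr_mono2) auto
    finally show ?thesis using X by (simp add: mult.assoc)
  qed
  have B: "c * 2 powr (1 + \<alpha>) \<le> B" "X * (1 + X) powr \<alpha> \<le> B"
    using X \<open>0 < c\<close> by (auto simp: B_def)
  have "\<bar>x\<bar> * phi \<sigma> x \<le> B * (1 + \<bar>x\<bar>) powr (- \<alpha>)" for x
  proof -
    have "phi \<sigma> x = phi \<sigma> \<bar>x\<bar>" using phi_minus[OF sym, of x] by (cases "0 \<le> x") auto
    then show ?thesis
      using far[of "\<bar>x\<bar>"] near[of "\<bar>x\<bar>"] B
      by (smt (verit) mult_right_mono powr_ge_zero)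
  qed
  moreover have "0 \<le> B" using X \<open>0 < c\<close> by (simp add: B_def)
  ultimately show ?thesis by blast
qed

text \<open>
  Somewhere on the right \<open>\<sigma>\<close> exceeds \<open>1/2\<close>, and by concavity its graph lies above the chord from
  \<open>0\<close> to that point, so \<open>\<sigma>\<close> has already risen strictly at \<open>1\<close>.
\<close>

lemma sigmoidal_concave_gt_half:
  assumes "sigmoidal \<sigma>" "concave_on {0..} \<sigma>" "\<sigma> 0 = 1 / 2"
  shows "1 / 2 < \<sigma> 1"
proof -
  have "\<forall>\<^sub>F x in at_top. 1 / 2 < \<sigma> x"
    using assms(1) by (intro order_tendstoD(1)[where y = 1]) (auto simp: sigmoidal_def)
  then have "\<forall>\<^sub>F x in at_top. 1 / 2 < \<sigma> x \<and> 1 \<le> x"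
    using eventually_ge_at_top by (rule eventually_conj)
  then obtain x where x: "1 / 2 < \<sigma> x" "1 \<le> x"
    by (auto dest!: eventually_happens'[rotated])
  have "\<sigma> ((1 - 1 / x) *\<^sub>R 0 + (1 / x) *\<^sub>R x) \<ge> (1 - 1 / x) * \<sigma> 0 + (1 / x) * \<sigma> x"
    using x by (intro concave_onD[OF assms(2)]) auto
  then have "\<sigma> 1 \<ge> 1 / 2 + (\<sigma> x - 1 / 2) / x"
    using x assms(3) by (simp add: field_simps)
  moreover have "(\<sigma> x - 1 / 2) / x > 0" using x by simp
  ultimately show ?thesis by linarith
qed

text \<open>
  For \<open>0 \<le> x \<le> 1\<close> the interval \<open>[x - 1, x + 1]\<close> contains \<open>[0, 1]\<close>, so the increment of \<open>\<sigma>\<close> over it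
  is at least \<open>\<sigma> 1 - \<sigma> 0\<close>. Evenness gives the other half.
\<close>

lemma phi_ge_near_zero:
  assumes "mono \<sigma>" and sym: "\<forall>x. \<sigma> (- x) - 1 / 2 = - (\<sigma> x - 1 / 2)" and "\<bar>x\<bar> \<le> 1"
  shows "(\<sigma> 1 - 1 / 2) / 2 \<le> phi \<sigma> x"
proof -
  have *: "(\<sigma> 1 - 1 / 2) / 2 \<le> phi \<sigma> y" if "0 \<le> y" "y \<le> 1" for y
  proof -
    have "\<sigma> 1 \<le> \<sigma> (y + 1)" "\<sigma> (y - 1) \<le> \<sigma> 0"
      using that assms(1) by (auto intro: monoD)
    then show ?thesis using sym[rule_format, of 0] by (simp add: phi_def)
  qed
  show ?thesis
    using *[of x] *[of "- x"] phi_minus[OF sym, of x] assms(3) by (cases "0 \<le> x") auto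
qed

lemma nearby_integer:
  fixes x :: real
  assumes "l \<le> x" "x \<le> u" "\<lceil>l\<rceil> \<le> \<lfloor>u\<rfloor>"
  shows "\<exists>k\<in>{\<lceil>l\<rceil>..\<lfloor>u\<rfloor>}. \<bar>x - real_of_int k\<bar> \<le> 1"
proof
  \<comment> \<open>The floor of \<open>x\<close> serves unless it falls below the range; then \<open>l \<le> x < \<lceil>l\<rceil> < l + 1\<close>.\<close>
  show "max \<lceil>l\<rceil> \<lfloor>x\<rfloor> \<in> {\<lceil>l\<rceil>..\<lfloor>u\<rfloor>}"
    using assms by (auto intro: floor_mono)
  show "\<bar>x - real_of_int (max \<lceil>l\<rceil> \<lfloor>x\<rfloor>)\<bar> \<le> 1"
    using assms by linarith
qed

text \<open>
  This is the one-dimensional core: the mean distance from \<open>x\<close> to the integers of a range around it,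
  weighted by \<open>\<phi>\<close>, is bounded however short the range is and wherever \<open>x\<close> lies in it. Truncation
  can shrink the normalising sum near the ends of the range, so its lower bound comes from
  the single term of a nearby integer.
\<close>

lemma phi_moment_ratio_bounded:
  assumes "sigmoidal \<sigma>" "mono \<sigma>"
    and sym: "\<forall>x. \<sigma> (- x) - 1 / 2 = - (\<sigma> x - 1 / 2)"
    and "concave_on {0..} \<sigma>"
    and "\<sigma> \<in> O[at_bot](\<lambda>x. \<bar>x\<bar> powr (- 1 - \<alpha>))" "1 < \<alpha>"
  shows "\<exists>K>0. \<forall>l u x. l \<le> x \<and> x \<le> u \<and> \<lceil>l\<rceil> \<le> \<lfloor>u\<rfloor> \<longrightarrow>
    0 < (\<Sum>k=\<lceil>l\<rceil>..\<lfloor>u\<rfloor>. phi \<sigma> (x - real_of_int k)) \<and>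
    (\<Sum>k=\<lceil>l\<rceil>..\<lfloor>u\<rfloor>. \<bar>x - real_of_int k\<bar> * phi \<sigma> (x - real_of_int k))
      \<le> K * (\<Sum>k=\<lceil>l\<rceil>..\<lfloor>u\<rfloor>. phi \<sigma> (x - real_of_int k))"
proof -
  obtain B where B: "0 \<le> B" "\<And>x. \<bar>x\<bar> * phi \<sigma> x \<le> B * (1 + \<bar>x\<bar>) powr (- \<alpha>)"
    using phi_first_moment_decay[OF assms(1-3,5)] assms(6) by auto
  obtain C where C: "0 \<le> C"
    "\<And>t A. finite A \<Longrightarrow> (\<Sum>k\<in>A. \<bar>t - real_of_int k\<bar> * phi \<sigma> (t - real_of_int k)) \<le> C"
    using sum_translates_bounded[OF assms(6) B] by blast
  define c where "c = (\<sigma> 1 - 1 / 2) / 2"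
  have "0 < c"
    using sigmoidal_concave_gt_half[OF assms(1,4)] sym[rule_format, of 0] by (simp add: c_def)
  define K where "K = (C + 1) / c"
  have "0 < K" using C(1) \<open>0 < c\<close> by (simp add: K_def)
  moreover have "0 < (\<Sum>k=\<lceil>l\<rceil>..\<lfloor>u\<rfloor>. phi \<sigma> (x - real_of_int k)) \<and>
    (\<Sum>k=\<lceil>l\<rceil>..\<lfloor>u\<rfloor>. \<bar>x - real_of_int k\<bar> * phi \<sigma> (x - real_of_int k))
      \<le> K * (\<Sum>k=\<lceil>l\<rceil>..\<lfloor>u\<rfloor>. phi \<sigma> (x - real_of_int k))"
    if range: "l \<le> x" "x \<le> u" "\<lceil>l\<rceil> \<le> \<lfloor>u\<rfloor>" for l u x
  proof -
    obtain k where k: "k \<in> {\<lceil>l\<rceil>..\<lfloor>u\<rfloor>}" "\<bar>x - real_of_int k\<bar> \<le> 1"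
      using nearby_integer[OF range] by blast
    have "c \<le> phi \<sigma> (x - real_of_int k)"
      unfolding c_def using assms(2) sym k(2) by (rule phi_ge_near_zero)
    also have "\<dots> \<le> (\<Sum>k=\<lceil>l\<rceil>..\<lfloor>u\<rfloor>. phi \<sigma> (x - real_of_int k))"
      using k(1) by (intro member_le_sum) (auto simp: phi_nonneg assms(2))
    finally have *: "c \<le> (\<Sum>k=\<lceil>l\<rceil>..\<lfloor>u\<rfloor>. phi \<sigma> (x - real_of_int k))" .
    have "(\<Sum>k=\<lceil>l\<rceil>..\<lfloor>u\<rfloor>. \<bar>x - real_of_int k\<bar> * phi \<sigma> (x - real_of_int k)) \<le> K * c"
      using C(2)[of "{\<lceil>l\<rceil>..\<lfloor>u\<rfloor>}" x] \<open>0 < c\<close> by (simp add: K_def)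
    also have "\<dots> \<le> K * (\<Sum>k=\<lceil>l\<rceil>..\<lfloor>u\<rfloor>. phi \<sigma> (x - real_of_int k))"
      using * \<open>0 < K\<close> by (intro mult_left_mono) auto
    finally show ?thesis using * \<open>0 < c\<close> by auto
  qed
  ultimately show ?thesis by blast
qed

section \<open>Lipschitz estimate from bounded partial derivatives\<close>

text \<open>
  The mean value inequality along a coordinate line. The partial derivative at \<open>x + t e\<^sub>i\<close> is taken
  at parameter \<open>0\<close> of the slice through that point; translating the slice by \<open>t\<close> makes it the
  derivative at \<open>t\<close> of one function on the slice through \<open>x\<close>.
\<close>

lemma axis_lipschitz:
  assumes "C1_on (cbox a b) f"
    and bound: "\<And>z. z \<in> cbox a b \<Longrightarrow> \<bar>partial (cbox a b) i f z\<bar> \<le> L"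
    and x: "x \<in> cbox a b" and y: "x + h *\<^sub>R axis i 1 \<in> cbox a b"
  shows "\<bar>f (x + h *\<^sub>R axis i 1) - f x\<bar> \<le> L * \<bar>h\<bar>"
proof -
  let ?S = "axis_slice (cbox a b) i x"
  define D where "D t = partial (cbox a b) i f (x + t *\<^sub>R axis i 1)" for t
  have der: "((\<lambda>s. f (x + s *\<^sub>R axis i 1)) has_field_derivative D t) (at t within ?S)"
    if "t \<in> ?S" for t
  proof -
    let ?z = "x + t *\<^sub>R axis i 1"
    have "?z \<in> cbox a b" using that by (simp add: axis_slice_def)
    then have "((\<lambda>s. f (?z + s *\<^sub>R axis i 1)) has_vector_derivative D t)
      (at 0 within axis_slice (cbox a b) i ?z)"
      using assms(1) by (auto simp: C1_on_def D_def partial_def vector_derivative_works)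
    then have *: "((\<lambda>s. f (?z + s *\<^sub>R axis i 1)) has_field_derivative D t)
      (at 0 within axis_slice (cbox a b) i ?z)"
      by (simp add: has_real_derivative_iff_has_vector_derivative)
    have "(\<lambda>s. s - t) ` ?S = axis_slice (cbox a b) i ?z"
    proof (intro set_eqI iffI)
      fix s assume "s \<in> axis_slice (cbox a b) i ?z"
      then have "s + t \<in> ?S" by (simp add: axis_slice_def algebra_simps)
      then show "s \<in> (\<lambda>s. s - t) ` ?S" by (intro image_eqI[of _ _ "s + t"]) auto
    qed (auto simp: axis_slice_def algebra_simps)
    then have **: "((\<lambda>s. f (?z + s *\<^sub>R axis i 1)) has_field_derivative D t)
      (at (t - t) within (\<lambda>s. s - t) ` ?S)"
      using * by simp
    have "((\<lambda>s. s - t) has_field_derivative 1) (at t within ?S)"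
      by (auto intro!: derivative_eq_intros)
    from DERIV_image_chain[OF ** this] show ?thesis
      by (simp add: o_def algebra_simps)
  qed
  have "convex ?S"
  proof (rule convexI)
    fix s t u v :: real
    assume "s \<in> ?S" "t \<in> ?S" "0 \<le> u" "0 \<le> v" "u + v = 1"
    moreover have "x + (u *\<^sub>R s + v *\<^sub>R t) *\<^sub>R axis i 1
      = u *\<^sub>R (x + s *\<^sub>R axis i 1) + v *\<^sub>R (x + t *\<^sub>R axis i 1)"
    proof -
      have "x = u *\<^sub>R x + v *\<^sub>R x"
        using \<open>u + v = 1\<close> by (simp flip: scaleR_add_left)
      then show ?thesis by (simp add: algebra_simps)
    qed
    ultimately show "u *\<^sub>R s + v *\<^sub>R t \<in> ?S"
      using convexD[OF convex_box(1)[of a b]] by (simp add: axis_slice_def)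
  qed
  moreover have "norm (D t) \<le> L" if "t \<in> ?S" for t
    using that bound by (auto simp: D_def axis_slice_def)
  moreover have "0 \<in> ?S" "h \<in> ?S"
    using x y by (auto simp: axis_slice_def)
  ultimately have "norm (f (x + h *\<^sub>R axis i 1) - f (x + 0 *\<^sub>R axis i 1)) \<le> L * norm (h - 0)"
    using der by (intro field_differentiable_bound[where S = ?S and f' = D]) auto
  then show ?thesis by simp
qed

text \<open>
  Two points of a rectangle are joined inside it by one segment parallel to each axis, so bounds on
  the partial derivatives suffice.
\<close>

lemma box_lipschitz:
  fixes x y :: "real ^ 2"
  assumes "C1_on (cbox a b) f"
    and bound: "\<And>i z. z \<in> cbox a b \<Longrightarrow> \<bar>partial (cbox a b) i f z\<bar> \<le> L"
    and x: "x \<in> cbox a b" and y: "y \<in> cbox a b"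
  shows "\<bar>f y - f x\<bar> \<le> L * (\<bar>y $ 1 - x $ 1\<bar> + \<bar>y $ 2 - x $ 2\<bar>)"
proof -
  define z where "z = x + (y $ 1 - x $ 1) *\<^sub>R axis 1 1"
  have y_eq: "y = z + (y $ 2 - x $ 2) *\<^sub>R axis 2 1"
    by (simp add: z_def vec_eq_iff forall_2 axis_def)
  have z: "z \<in> cbox a b"
    using x y by (simp add: z_def mem_box_cart forall_2 axis_def)
  have "\<bar>f z - f x\<bar> \<le> L * \<bar>y $ 1 - x $ 1\<bar>"
    unfolding z_def using assms(1) bound x z[unfolded z_def] by (rule axis_lipschitz)
  moreover have "\<bar>f y - f z\<bar> \<le> L * \<bar>y $ 2 - x $ 2\<bar>"
    using axis_lipschitz[OF assms(1) bound z, where i = 2 and h = "y $ 2 - x $ 2"] y y_eq by simp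
  ultimately show ?thesis
    by (simp add: distrib_left)
qed

section \<open>Pointwise error of the operator\<close>

lemma sum_grid_prod:
  fixes u v :: "int \<Rightarrow> real"
  shows "(\<Sum>k\<in>grid a b n. u (k $ 1) * v (k $ 2)) =
    (\<Sum>i=\<lceil>real n * a $ 1\<rceil>..\<lfloor>real n * b $ 1\<rfloor>. u i) * (\<Sum>j=\<lceil>real n * a $ 2\<rceil>..\<lfloor>real n * b $ 2\<rfloor>. v j)"
proof -
  have "(\<Sum>k\<in>grid a b n. u (k $ 1) * v (k $ 2)) =
    (\<Sum>(i, j)\<in>{\<lceil>real n * a $ 1\<rceil>..\<lfloor>real n * b $ 1\<rfloor>} \<times> {\<lceil>real n * a $ 2\<rceil>..\<lfloor>real n * b $ 2\<rfloor>}. u i * v j)"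
    by (rule sum.reindex_bij_witness[where i = "\<lambda>(i, j). vector [i, j]" and j = "\<lambda>k. (k $ 1, k $ 2)"])
       (auto simp: grid_def forall_2 vec_eq_iff vector_2)
  then show ?thesis
    by (simp add: sum_product sum.cartesian_product)
qed

text \<open>
  The normalising sum factors as \<open>T\<^sub>1 T\<^sub>2\<close>, and the error sum is bounded by
  \<open>L/n (S\<^sub>1 T\<^sub>2 + T\<^sub>1 S\<^sub>2)\<close>, where \<open>S\<^sub>i\<close> is the truncated first moment in coordinate \<open>i\<close>. The quotient is
  \<open>L/n (S\<^sub>1/T\<^sub>1 + S\<^sub>2/T\<^sub>2)\<close>, so the assumption \<open>S\<^sub>i \<le> K T\<^sub>i\<close> bounds it without separate bounds on
  the sums.
\<close>

lemma nn_op_error: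
  fixes x :: "real ^ 2"
  assumes "mono \<sigma>" "1 \<le> n" "grid a b n \<noteq> {}" and x: "x \<in> cbox a b"
    and K: "\<And>l u x. l \<le> x \<Longrightarrow> x \<le> u \<Longrightarrow> \<lceil>l\<rceil> \<le> \<lfloor>u\<rfloor> \<Longrightarrow>
      0 < (\<Sum>k=\<lceil>l\<rceil>..\<lfloor>u\<rfloor>. phi \<sigma> (x - real_of_int k)) \<and>
      (\<Sum>k=\<lceil>l\<rceil>..\<lfloor>u\<rfloor>. \<bar>x - real_of_int k\<bar> * phi \<sigma> (x - real_of_int k))
        \<le> K * (\<Sum>k=\<lceil>l\<rceil>..\<lfloor>u\<rfloor>. phi \<sigma> (x - real_of_int k))"
    and "0 \<le> L"
    and lip: "\<And>y. y \<in> cbox a b \<Longrightarrow> \<bar>f y - f x\<bar> \<le> L * (\<bar>y $ 1 - x $ 1\<bar> + \<bar>y $ 2 - x $ 2\<bar>)"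
  shows "\<bar>nn_op \<sigma> a b n f x - f x\<bar> \<le> L * (2 * K / real n)"
proof -
  let ?G = "grid a b n"
  define P where "P k = Psi \<sigma> (real n *\<^sub>R x - vec_of_int k)" for k
  define w where "w i k = phi \<sigma> (real n * x $ i - real_of_int k)" for i k
  define d where "d i k = \<bar>real n * x $ i - real_of_int k\<bar>" for i k
  define A where "A i = {\<lceil>real n * a $ i\<rceil>..\<lfloor>real n * b $ i\<rfloor>}" for i
  define T where "T i = (\<Sum>k\<in>A i. w i k)" for i
  define S where "S i = (\<Sum>k\<in>A i. d i k * w i k)" for i
  have n: "0 < real n" using assms(2) by simp
  have T: "0 < T i" and S: "S i \<le> K * T i" for i
  proof -
    obtain k where "k \<in> ?G" using assms(3) by blast
    then have "\<lceil>real n * a $ i\<rceil> \<le> \<lfloor>real n * b $ i\<rfloor>"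
      by (auto simp: grid_def intro: order_trans)
    moreover have "real n * a $ i \<le> real n * x $ i" "real n * x $ i \<le> real n * b $ i"
      using x n by (auto simp: mem_box_cart)
    ultimately show "0 < T i" "S i \<le> K * T i"
      using K unfolding T_def S_def w_def d_def A_def by auto
  qed
  have P: "P k = w 1 (k $ 1) * w 2 (k $ 2)" for k
    by (simp add: P_def w_def Psi_def vec_of_int_def)
  have P0: "0 \<le> P k" for k
    unfolding P w_def using phi_nonneg[OF assms(1)] by simp
  have den: "(\<Sum>k\<in>?G. P k) = T 1 * T 2"
    unfolding P T_def A_def by (rule sum_grid_prod)
  have den0: "0 < T 1 * T 2" using T by simp
  have "nn_op \<sigma> a b n f x - f x = (\<Sum>k\<in>?G. (f (vec_of_int k /\<^sub>R real n) - f x) * P k) / (T 1 * T 2)"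
  proof -
    have "(\<Sum>k\<in>?G. (f (vec_of_int k /\<^sub>R real n) - f x) * P k)
      = (\<Sum>k\<in>?G. f (vec_of_int k /\<^sub>R real n) * P k) - f x * (T 1 * T 2)"
      by (simp add: left_diff_distrib sum_subtractf den[symmetric] sum_distrib_left)
    then show ?thesis
      using T[of 1] T[of 2] den by (simp add: nn_op_def P_def diff_divide_distrib)
  qed
  also have "\<bar>\<dots>\<bar> \<le> (\<Sum>k\<in>?G. L / real n * ((d 1 (k $ 1) + d 2 (k $ 2)) * P k)) / (T 1 * T 2)"
  proof -
    have "\<bar>(f (vec_of_int k /\<^sub>R real n) - f x) * P k\<bar>
      \<le> L / real n * ((d 1 (k $ 1) + d 2 (k $ 2)) * P k)" if "k \<in> ?G" for k
    proof -
      have dist_eq: "\<bar>(vec_of_int k /\<^sub>R real n) $ i - x $ i\<bar> = d i (k $ i) / real n" for i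
      proof -
        have "(vec_of_int k /\<^sub>R real n) $ i - x $ i = - ((real n * x $ i - real_of_int (k $ i)) / real n)"
          using n by (simp add: vec_of_int_def field_simps)
        then show ?thesis using n by (simp add: d_def)
      qed
      have "vec_of_int k /\<^sub>R real n \<in> cbox a b"
        using that n
        by (auto simp: grid_def mem_box_cart vec_of_int_def ceiling_le_iff le_floor_iff field_simps)
      from lip[OF this] have "\<bar>f (vec_of_int k /\<^sub>R real n) - f x\<bar>
        \<le> L * (d 1 (k $ 1) / real n + d 2 (k $ 2) / real n)"
        by (simp only: dist_eq)
      then have "\<bar>f (vec_of_int k /\<^sub>R real n) - f x\<bar> \<le> L / real n * (d 1 (k $ 1) + d 2 (k $ 2))"
        by (simp add: distrib_left add_divide_distrib)
      then have "\<bar>f (vec_of_int k /\<^sub>R real n) - f x\<bar> * P k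
        \<le> L / real n * (d 1 (k $ 1) + d 2 (k $ 2)) * P k"
        using P0 by (rule mult_right_mono)
      then show ?thesis using P0[of k] by (simp add: abs_mult mult.assoc)
    qed
    then show ?thesis
      using den0 by (auto intro!: divide_right_mono order_trans[OF sum_abs] sum_mono)
  qed
  also have "(\<Sum>k\<in>?G. L / real n * ((d 1 (k $ 1) + d 2 (k $ 2)) * P k))
    = L / real n * (S 1 * T 2 + T 1 * S 2)"
  proof -
    have "(\<Sum>k\<in>?G. (d 1 (k $ 1) + d 2 (k $ 2)) * P k)
      = (\<Sum>k\<in>?G. d 1 (k $ 1) * w 1 (k $ 1) * w 2 (k $ 2))
      + (\<Sum>k\<in>?G. w 1 (k $ 1) * (d 2 (k $ 2) * w 2 (k $ 2)))"
      by (simp add: P algebra_simps sum.distrib)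
    also have "\<dots> = S 1 * T 2 + T 1 * S 2"
      unfolding S_def T_def A_def
      by (intro arg_cong2[where f = "(+)"] sum_grid_prod[where u = "\<lambda>k. d 1 k * w 1 k"]
          sum_grid_prod[where v = "\<lambda>k. d 2 k * w 2 k"])
    finally show ?thesis by (simp only: sum_distrib_left[symmetric])
  qed
  also have "L / real n * (S 1 * T 2 + T 1 * S 2) / (T 1 * T 2)
    \<le> L / real n * (2 * K * (T 1 * T 2)) / (T 1 * T 2)"
  proof -
    have "S 1 * T 2 \<le> K * T 1 * T 2" "T 1 * S 2 \<le> T 1 * (K * T 2)"
      using S T by (auto intro!: mult_right_mono mult_left_mono simp: less_imp_le)
    then have "S 1 * T 2 + T 1 * S 2 \<le> 2 * K * (T 1 * T 2)"
      by (simp add: algebra_simps)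
    then show ?thesis
      using \<open>0 \<le> L\<close> n den0 by (intro divide_right_mono mult_left_mono) auto
  qed
  also have "\<dots> = L * (2 * K / real n)"
    using T[of 1] T[of 2] by simp
  finally show ?thesis .
qed

section \<open>Comparison with the Lebesgue norms\<close>

text \<open>
  When \<open>\<bar>g\<bar>\<^sup>p\<close> is not integrable, its Bochner integral is \<open>0\<close> by convention and the bound is trivial;
  otherwise the integral is monotone.
\<close>

lemma Lp_norm_le_of_bound:
  assumes "1 \<le> p" "0 \<le> E" and g: "\<And>x. x \<in> cbox a b \<Longrightarrow> \<bar>g x\<bar> \<le> E"
  shows "Lp_norm p (cbox a b) g \<le> E * measure lebesgue (cbox a b) powr (1 / p)"
proof -
  let ?S = "cbox a b"
  let ?h = "\<lambda>x. \<bar>g x\<bar> powr p"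
  have I: "(LINT x:?S|lebesgue. ?h x) \<le> E powr p * measure lebesgue ?S"
  proof (cases "set_integrable lebesgue ?S ?h")
    case True
    have c: "set_integrable lebesgue ?S (\<lambda>x. E powr p)"
      by (intro absolutely_integrable_on_const) simp
    have "(LINT x:?S|lebesgue. ?h x) \<le> (LINT x:?S|lebesgue. E powr p)"
      using True c g assms(1) by (intro set_integral_mono powr_mono2) auto
    then show ?thesis by (simp add: set_lebesgue_integral_def mult.commute)
  next
    case False
    then have "(LINT x:?S|lebesgue. ?h x) = 0"
      by (simp add: set_lebesgue_integral_def set_integrable_def not_integrable_integral_eq)
    then show ?thesis by simp
  qed
  have "0 \<le> (LINT x:?S|lebesgue. ?h x)"
    unfolding set_lebesgue_integral_def by (rule integral_nonneg_AE) simp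
  then have "Lp_norm p ?S g \<le> (E powr p * measure lebesgue ?S) powr (1 / p)"
    unfolding Lp_norm_def using I assms(1) by (intro powr_mono2) auto
  also have "\<dots> = E * measure lebesgue ?S powr (1 / p)"
    using assms(1,2) by (simp add: powr_mult powr_powr)
  finally show ?thesis .
qed

text \<open>
  For a lower bound the integral must be the true one; continuity on the compact rectangle
  guarantees this.
\<close>

lemma Lp_norm_ge_of_bound:
  assumes "1 \<le> p" "0 \<le> \<beta>" "continuous_on (cbox a b) g"
    and g: "\<And>x. x \<in> cbox a b \<Longrightarrow> \<beta> \<le> \<bar>g x\<bar> powr p"
  shows "(\<beta> * measure lebesgue (cbox a b)) powr (1 / p) \<le> Lp_norm p (cbox a b) g"
proof -
  let ?S = "cbox a b"
  have "continuous_on ?S (\<lambda>x. \<bar>g x\<bar> powr p)"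
    using assms(1,3) by (intro continuous_intros continuous_on_powr') auto
  then have "set_integrable lborel ?S (\<lambda>x. \<bar>g x\<bar> powr p)"
    unfolding set_integrable_def by (intro borel_integrable_compact) auto
  then have int: "set_integrable lebesgue ?S (\<lambda>x. \<bar>g x\<bar> powr p)"
    unfolding set_integrable_def by (intro integrable_completion[THEN iffD2]) auto
  have c: "set_integrable lebesgue ?S (\<lambda>x. \<beta>)"
    by (intro absolutely_integrable_on_const) simp
  have "(LINT x:?S|lebesgue. \<beta>) \<le> (LINT x:?S|lebesgue. \<bar>g x\<bar> powr p)"
    using int c g by (intro set_integral_mono) auto
  then have "\<beta> * measure lebesgue ?S \<le> (LINT x:?S|lebesgue. \<bar>g x\<bar> powr p)"
    by (simp add: set_lebesgue_integral_def mult.commute)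
  then show ?thesis
    unfolding Lp_norm_def using assms(1,2) by (intro powr_mono2) auto
qed

lemma Lp_norm_partial_le_Sobolev_norm: "Lp_norm p S (partial S i f) \<le> Sobolev_norm p S f"
proof -
  have "Lp_norm p S (partial S i f) \<le> (\<Sum>i\<in>UNIV. Lp_norm p S (partial S i f))"
    by (intro member_le_sum) (auto simp: Lp_norm_def)
  then show ?thesis
    by (simp add: Sobolev_norm_def Lp_norm_def add_increasing)
qed

theorem theorem4:
  fixes p :: real and \<sigma> :: "real \<Rightarrow> real" and a b :: "real ^ 2"
  assumes "1 \<le> p"
    and "\<forall>i. a $ i < b $ i"
    and "sigmoidal \<sigma>"
    and "mono \<sigma>"
    and "\<forall>x. \<sigma> (- x) - 1 / 2 = - (\<sigma> x - 1 / 2)"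
    and "C2_real \<sigma>"
    and "concave_on {0..} \<sigma>"
    and "\<exists>\<alpha>>p. \<sigma> \<in> O[at_bot](\<lambda>x. \<bar>x\<bar> powr (- 1 - \<alpha>))"
  shows "\<exists>K\<^sub>1>0. \<forall>f M \<beta>.
           C1_on (cbox a b) f \<and> M > 0 \<and> \<beta> > 0 \<and>
           (\<forall>x\<in>cbox a b. \<forall>i. M \<ge> \<bar>partial (cbox a b) i f x\<bar> powr p \<and>
                                \<bar>partial (cbox a b) i f x\<bar> powr p \<ge> \<beta>) \<longrightarrow>
           (\<forall>n\<ge>1. grid a b n \<noteq> {} \<longrightarrow>
              Lp_norm p (cbox a b) (\<lambda>x. nn_op \<sigma> a b n f x - f x)
                \<le> K\<^sub>1 / real n * (M / \<beta>) powr (1 / p) * Sobolev_norm p (cbox a b) f)"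
proof -
  obtain \<alpha> where "p < \<alpha>" and bigo: "\<sigma> \<in> O[at_bot](\<lambda>x. \<bar>x\<bar> powr (- 1 - \<alpha>))"
    using assms(8) by blast
  then have "1 < \<alpha>" using assms(1) by simp
  obtain K where "0 < K" and K: "\<And>l u x. l \<le> x \<Longrightarrow> x \<le> u \<Longrightarrow> \<lceil>l\<rceil> \<le> \<lfloor>u\<rfloor> \<Longrightarrow>
      0 < (\<Sum>k=\<lceil>l\<rceil>..\<lfloor>u\<rfloor>. phi \<sigma> (x - real_of_int k)) \<and>
      (\<Sum>k=\<lceil>l\<rceil>..\<lfloor>u\<rfloor>. \<bar>x - real_of_int k\<bar> * phi \<sigma> (x - real_of_int k))
        \<le> K * (\<Sum>k=\<lceil>l\<rceil>..\<lfloor>u\<rfloor>. phi \<sigma> (x - real_of_int k))"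
    using phi_moment_ratio_bounded[OF assms(3-5,7) bigo \<open>1 < \<alpha>\<close>] by blast
  let ?I = "cbox a b"
  have "Lp_norm p ?I (\<lambda>x. nn_op \<sigma> a b n f x - f x)
      \<le> 2 * K / real n * (M / \<beta>) powr (1 / p) * Sobolev_norm p ?I f"
    if C1: "C1_on ?I f" and "M > 0" "\<beta> > 0"
      and bounds: "\<forall>x\<in>?I. \<forall>i. M \<ge> \<bar>partial ?I i f x\<bar> powr p \<and> \<bar>partial ?I i f x\<bar> powr p \<ge> \<beta>"
      and n: "n \<ge> 1" "grid a b n \<noteq> {}" for f M \<beta> and n :: nat
  proof -
    define L where "L = M powr (1 / p)"
    have "0 \<le> L" by (simp add: L_def)
    have partial_le: "\<bar>partial ?I i f z\<bar> \<le> L" if "z \<in> ?I" for i z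
    proof -
      have "(\<bar>partial ?I i f z\<bar> powr p) powr (1 / p) \<le> M powr (1 / p)"
        using bounds that assms(1) by (intro powr_mono2) auto
      then show ?thesis using assms(1) by (simp add: powr_powr L_def)
    qed
    have "\<bar>nn_op \<sigma> a b n f x - f x\<bar> \<le> L * (2 * K / real n)" if "x \<in> ?I" for x
      using assms(4) n that K \<open>0 \<le> L\<close> box_lipschitz[OF C1 partial_le that]
      by (rule nn_op_error)
    then have "Lp_norm p ?I (\<lambda>x. nn_op \<sigma> a b n f x - f x)
        \<le> L * (2 * K / real n) * measure lebesgue ?I powr (1 / p)"
      using assms(1) \<open>0 \<le> L\<close> \<open>0 < K\<close> by (intro Lp_norm_le_of_bound) auto
    \<comment> \<open>Splitting \<open>M = (M/\<beta>) \<beta>\<close> leaves \<open>(\<beta> \<bar>I\<bar>)\<^sup>1\<^sup>/\<^sup>p\<close>, which the norm of a partial derivative absorbs.\<close>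
    also have "\<dots> = 2 * K / real n * (M / \<beta>) powr (1 / p) * (\<beta> * measure lebesgue ?I) powr (1 / p)"
      using \<open>M > 0\<close> \<open>\<beta> > 0\<close> by (simp add: L_def powr_divide powr_mult)
    also have "\<dots> \<le> 2 * K / real n * (M / \<beta>) powr (1 / p) * Sobolev_norm p ?I f"
    proof (rule mult_left_mono)
      have "(\<beta> * measure lebesgue ?I) powr (1 / p) \<le> Lp_norm p ?I (partial ?I 1 f)"
        using assms(1) \<open>\<beta> > 0\<close> C1 bounds by (intro Lp_norm_ge_of_bound) (auto simp: C1_on_def)
      also have "\<dots> \<le> Sobolev_norm p ?I f"
        by (rule Lp_norm_partial_le_Sobolev_norm)
      finally show "(\<beta> * measure lebesgue ?I) powr (1 / p) \<le> Sobolev_norm p ?I f" .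
    qed (use \<open>0 < K\<close> in auto)
    finally show ?thesis .
  qed
  then show ?thesis
    using \<open>0 < K\<close> by (intro exI[of _ "2 * K"]) auto
qed

end
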